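(* Let $E\in C^3(\mathbb{R}^d,\mathbb{R})$, let $x^*$ be an index-$k$ saddle point of $E$, let $\delta>0$ and $U(x^*,\delta)=\{x\in\mathbb{R}^d : \|x-x^*\|_2<\delta\}$. Assume: (a) there is a constant $M>0$ such that $\|\nabla^2E(x)-\nabla^2E(y)\|_2\leqslant M\|x-y\|_2$ for all $x,y\in U(x^*,\delta)$; (b) there are constants $0<\epsilon<\mu<L$ such that for every $x\in U(x^*,\delta)$ the eigenvalues $\lambda_1\leqslant\dots\leqslant\lambda_d$ of $\nabla^2E(x)$ satisfy $\lambda_1\leqslant\dots\leqslant\lambda_k<0<\lambda_{k+1}\leqslant\dots\leqslant\lambda_d$, $|\lambda_i|\in[\epsilon,L]$ for $1\leqslant i\leqslant k$, and $|\lambda_i|\in[\mu,L]$ for $k+1\leqslant i\leqslant d$. Suppose the initial guess $x^{(0)}\in\mathbb{R}^d$ satisfies $$r_0=\|x^{(0)}-x^*\|_2<\min\{\delta,\hat r\},\qquad \hat r=\frac{2\epsilon}{M},$$ and let $(x^{(n)})_{n\geqslant0}$ be generated by $$x^{(n+1)} = x^{(n)} - \beta_n \left( I - \sum_{i=1}^k\left(1+\frac{\eta_n}{|\lambda_i^{(n)}|}\right) u_i^{(n)} u_i^{(n)\top} \right) \nabla E(x^{(n)}),$$ with $\beta_n=\frac{2}{L+\mu}$ and $\eta_n=\mu$ for all $n\geqslant0$, where $\lambda_1^{(n)}\leqslant\dots\leqslant\lambda_k^{(n)}$ are the $k$ smallest eigenvalues of $\nabla^2E(x^{(n)})$ and $u_1^{(n)},\dots,u_k^{(n)}$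 are corresponding orthonormal eigenvectors. Then $x^{(n)}$ converges to $x^*$ with a linear convergence rate: for all $n\geqslant0$, $$r_n=\|x^{(n)}-x^*\|_2\leqslant\left(1-\frac{2}{\kappa+3}\right)^n\frac{\hat r\, r_0}{\hat r-r_0},\qquad \kappa=\frac{L}{\mu}.$$
   Context: A point $x^*$ is an index-$k$ saddle point of $E$ if $\nabla E(x^* )=0$ and $\nabla^2E(x^* )$ has exactly $k$ negative eigenvalues; it is assumed nondegenerate, i.e. $\nabla^2E(x^* )$ has no zero eigenvalue. $\|\cdot\|_2$ is the Euclidean norm for vectors and the induced operator norm for matrices. Eigenvalues are counted with multiplicity. *)

theory Defs
  imports "HOL-Analysis.Analysis" "HOL-Computational_Algebra.Computational_Algebra"
begin

text \<open>Iterated partial derivatives up to order \<open>m\<close> exist and are continuous. Every derivative of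
  order below \<open>m\<close> is required to be Frechet differentiable, which is automatic for functions whose
  partial derivatives are continuous.\<close>

fun C_k :: "nat \<Rightarrow> (real ^ 'd \<Rightarrow> real) \<Rightarrow> bool" where
  "C_k 0 f \<longleftrightarrow> continuous_on UNIV f"
| "C_k (Suc m) f \<longleftrightarrow>
     f differentiable_on UNIV \<and> (\<forall>i. C_k m (\<lambda>x. frechet_derivative f (at x) (axis i 1)))"

definition grad :: "(real ^ 'd \<Rightarrow> real) \<Rightarrow> real ^ 'd \<Rightarrow> real ^ 'd" where
  "grad f x = (\<chi> i. frechet_derivative f (at x) (axis i 1))"

definition hessian :: "(real ^ 'd \<Rightarrow> real) \<Rightarrow> real ^ 'd \<Rightarrow> real ^ 'd ^ 'd" where
  "hessian f x = jacobian (grad f) (at x)"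

text \<open>The type \<^typ>\<open>real ^ 'd ^ 'd\<close> carries the Frobenius norm, so the induced norm is a
  separate notion.\<close>

definition op_norm :: "real ^ 'd ^ 'd \<Rightarrow> real" where
  "op_norm A = onorm (\<lambda>v. A *v v)"

definition charpoly :: "real ^ 'd ^ 'd \<Rightarrow> real poly" where
  "charpoly A = det (mat [:0, 1:] - map_matrix (\<lambda>a. [:a:]) A)"

text \<open>Real eigenvalues with algebraic multiplicity. A symmetric matrix, such as the Hessian of a
  \<open>C\<^sup>3\<close> function, has \<^term>\<open>CARD('d)\<close> of them.\<close>

definition eigenvalues :: "real ^ 'd ^ 'd \<Rightarrow> real multiset" where
  "eigenvalues A = proots (charpoly A)"

text \<open>The \<open>i\<close>-th smallest eigenvalue, where \<open>i\<close> ranges over \<open>1, \<dots>, d\<close> (not from \<open>0\<close>). Outside this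
  range, or if there are fewer than \<open>i\<close> real eigenvalues, the value is unspecified.\<close>

definition eigval :: "real ^ 'd ^ 'd \<Rightarrow> nat \<Rightarrow> real" where
  "eigval A i = sorted_list_of_multiset (eigenvalues A) ! (i - 1)"

text \<open>Nondegeneracy is part of the notion.\<close>

definition index_saddle :: "nat \<Rightarrow> (real ^ 'd \<Rightarrow> real) \<Rightarrow> real ^ 'd \<Rightarrow> bool" where
  "index_saddle k f x \<longleftrightarrow>
     grad f x = 0 \<and>
     size {#l \<in># eigenvalues (hessian f x). l < 0#} = k \<and>
     0 \<notin># eigenvalues (hessian f x)"

definition outer :: "real ^ 'd \<Rightarrow> real ^ 'd \<Rightarrow> real ^ 'd ^ 'd" where
  "outer u v = (\<chi> i j. u $ i * v $ j)"

end

(* The preconditioner P = I - sum_i (1 + mu/|lam_i|) u_i u_i^T commutes with the Hessian A at the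
   current iterate: in a common orthonormal eigenbasis P * A has eigenvalue mu on the unstable
   directions u_i and the eigenvalues of A, lying in [mu, L], on the others. Hence I - 2/(L + mu) P A
   has norm at most (L - mu)/(L + mu), while P has norm at most mu/eps. Since the Lipschitz bound gives
   |A e - grad E| <= M/2 |e|^2 for the error e, one obtains
   r' <= (1 - q) r + q r^2 / rhat with q = 2/(kappa + 1), and the quantity rhat r / (rhat - r)
   contracts by the factor 1/(1 + q) = 1 - 2/(kappa + 3) in each step. *)

theory Submission
  imports Defs
begin

section \<open>Orthonormal eigenbases of self-adjoint maps\<close>

text \<open>A maximizer \<open>v\<close> of \<open>z \<bullet> f z\<close> over the compact unit
  sphere of \<open>S\<close> works. With \<open>l\<close> the maximum, the form
  \<open>l * (z \<bullet> z) - z \<bullet> f z\<close> is nonnegative on \<open>S\<close> and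
  vanishes at \<open>v\<close>, so its first variation at \<open>v\<close> vanishes, which forces
  \<open>f v = l *\<^sub>R v\<close>.\<close>

lemma selfadjoint_eigenvector_exists:
  fixes f :: "'a::euclidean_space \<Rightarrow> 'a"
  assumes lin: "linear f" and sa: "\<And>x y. f x \<bullet> y = x \<bullet> f y"
    and S: "subspace S" and inv: "f ` S \<subseteq> S" and nontrivial: "S \<noteq> {0}"
  obtains v where "v \<in> S" "norm v = 1" "f v = (v \<bullet> f v) *\<^sub>R v"
proof -
  have "0 \<in> S" using S by (rule subspace_0)
  then obtain w where w: "w \<in> S" "w \<noteq> 0" using nontrivial by auto
  have "compact (S \<inter> sphere 0 1)"
    using closed_subspace[OF S] by (simp add: closed_Int_compact)
  moreover have "w /\<^sub>R norm w \<in> S \<inter> sphere 0 1"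
    using w S by (auto simp: subspace_scale)
  moreover have cf: "continuous_on (S \<inter> sphere 0 1) (\<lambda>v. v \<bullet> f v)"
    using lin by (intro continuous_intros linear_continuous_on) (simp add: linear_conv_bounded_linear)
  ultimately obtain v where v: "v \<in> S" "norm v = 1"
    and vmax: "\<And>z. z \<in> S \<Longrightarrow> norm z = 1 \<Longrightarrow> z \<bullet> f z \<le> v \<bullet> f v"
    using continuous_attains_sup[OF _ _ cf] by (metis IntE IntI empty_iff mem_sphere_0)
  define l where "l = v \<bullet> f v"
  have form: "0 \<le> l * (z \<bullet> z) - z \<bullet> f z" if "z \<in> S" for z
  proof (cases "z = 0")
    case False
    define n where "n = norm z"
    have n: "n > 0" "z \<bullet> z = n\<^sup>2" using False by (auto simp: n_def power2_norm_eq_inner)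
    have "(z /\<^sub>R n) \<bullet> f (z /\<^sub>R n) \<le> l"
      unfolding l_def using that S False by (intro vmax) (auto simp: n_def subspace_scale)
    then have "(z \<bullet> f z) / n\<^sup>2 \<le> l"
      by (simp add: linear_cmul[OF lin] power2_eq_square divide_simps)
    then show ?thesis using n by (simp add: field_simps)
  qed auto
  \<comment> \<open>Invariance of \<open>S\<close> makes the residual an admissible direction; along
    it the form has first-order coefficient \<open>2 * (w \<bullet> w)\<close>.\<close>
  define w where "w = l *\<^sub>R v - f v"
  have wS: "w \<in> S" unfolding w_def using v inv S by (auto simp: subspace_diff subspace_scale)
  define c where "c = l * (w \<bullet> w) - w \<bullet> f w"
  have c0: "c \<ge> 0" unfolding c_def by (rule form[OF wS])
  have vv: "v \<bullet> v = 1" using v by (simp add: dot_square_norm)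
  have quad: "0 \<le> 2 * t * (w \<bullet> w) + t\<^sup>2 * c" for t
  proof -
    have "0 \<le> l * ((v + t *\<^sub>R w) \<bullet> (v + t *\<^sub>R w)) - (v + t *\<^sub>R w) \<bullet> f (v + t *\<^sub>R w)"
      by (rule form) (use v wS S in \<open>auto simp: subspace_add subspace_scale\<close>)
    also have "\<dots> = l * (v \<bullet> v) - v \<bullet> f v + 2 * t * (l * (v \<bullet> w) - f v \<bullet> w) + t\<^sup>2 * c"
    proof -
      have "v \<bullet> f w = f v \<bullet> w" "w \<bullet> f v = f v \<bullet> w" "w \<bullet> v = v \<bullet> w"
        using sa[of v w] sa[of w v] by (simp_all add: inner_commute)
      then show ?thesis
        by (simp add: c_def linear_add[OF lin] linear_cmul[OF lin] inner_add_left inner_add_right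
            power2_eq_square algebra_simps)
    qed
    also have "l * (v \<bullet> w) - f v \<bullet> w = w \<bullet> w"
      by (simp add: w_def inner_diff_left)
    finally show ?thesis by (simp add: l_def vv)
  qed
  have "w \<bullet> w = 0"
  proof (rule ccontr)
    assume "w \<bullet> w \<noteq> 0"
    then have p: "w \<bullet> w > 0" by simp
    \<comment> \<open>Dividing by \<open>c + 1\<close> covers \<open>c = 0\<close> and keeps
      \<open>- t * c\<close> below \<open>w \<bullet> w\<close>, so the linear term wins and the
      form would become negative.\<close>
    define t where "t = - (w \<bullet> w) / (c + 1)"
    have "t * c = - (w \<bullet> w) * (c / (c + 1))" by (simp add: t_def)
    moreover have "c / (c + 1) \<ge> 0" using c0 by simp
    moreover have "c / (c + 1) < 1" using c0 by simp
    ultimately have "2 * (w \<bullet> w) + t * c > 0"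
      using p by (smt (verit) mult_less_cancel_left2 mult_minus_left)
    moreover have "t < 0" using p c0 by (simp add: t_def divide_neg_pos)
    ultimately have "t * (2 * (w \<bullet> w) + t * c) < 0" by (simp add: mult_neg_pos)
    then show False using quad[of t] by (simp add: algebra_simps power2_eq_square)
  qed
  then show ?thesis using that[of v] v by (simp add: w_def l_def)
qed

text \<open>The orthogonal complement of a set of eigenvectors is invariant under a self-adjoint
  map, so it contains a further unit eigenvector until the dimension is exhausted. An empty
  \<open>B\<close> gives the spectral theorem; a general \<open>B\<close> lets prescribed
  eigenvectors be part of the basis.\<close>

lemma selfadjoint_eigenbasis_extend:
  fixes f :: "'a::euclidean_space \<Rightarrow> 'a"
  assumes lin: "linear f" and sa: "\<And>x y. f x \<bullet> y = x \<bullet> f y"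
    and "pairwise orthogonal B" and "\<And>b. b \<in> B \<Longrightarrow> norm b = 1 \<and> f b = (b \<bullet> f b) *\<^sub>R b"
  obtains C where "B \<subseteq> C" "pairwise orthogonal C" "card C = DIM('a)"
    "\<And>b. b \<in> C \<Longrightarrow> norm b = 1 \<and> f b = (b \<bullet> f b) *\<^sub>R b"
  using assms(3,4)
proof (induction "DIM('a) - card B" arbitrary: B thesis rule: less_induct)
  case less
  have "0 \<notin> B" using less.prems(3) by fastforce
  then have ind: "independent B"
    using less.prems(2) by (rule pairwise_orthogonal_independent[rotated])
  then have finB: "finite B" and cB: "card B \<le> DIM('a)" using independent_bound by auto
  show ?case
  proof (cases "card B = DIM('a)")
    case True
    then show ?thesis using less.prems by blast
  next
    case False
    then have "dim B < DIM('a)" using cB dim_eq_card_independent[OF ind] by linarith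
    then obtain x where x: "x \<noteq> 0" "\<And>y. y \<in> span B \<Longrightarrow> orthogonal x y"
      using orthogonal_to_subspace_exists by blast
    define S where "S = {v. \<forall>b\<in>B. v \<bullet> b = 0}"
    have "subspace S" by (auto simp: S_def subspace_def inner_simps)
    moreover have "f ` S \<subseteq> S"
    proof clarify
      fix v assume v: "v \<in> S"
      have "f v \<bullet> b = 0" if "b \<in> B" for b
      proof -
        have "f v \<bullet> b = v \<bullet> f b" by (rule sa)
        also have "f b = (b \<bullet> f b) *\<^sub>R b" using less.prems(3) that by blast
        finally show ?thesis using v that by (simp add: S_def)
      qed
      then show "f v \<in> S" by (simp add: S_def)
    qed
    moreover have "x \<in> S" using x by (auto simp: S_def orthogonal_def span_base)
    ultimately obtain v where v: "v \<in> S" "norm v = 1" "f v = (v \<bullet> f v) *\<^sub>R v"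
      using selfadjoint_eigenvector_exists[OF lin sa] x(1) by (metis singletonD)
    have "v \<notin> B" using v by (auto simp: S_def dot_square_norm)
    then have "card (insert v B) = Suc (card B)" using finB by simp
    then have "DIM('a) - card (insert v B) < DIM('a) - card B" using cB False by simp
    moreover have "pairwise orthogonal (insert v B)"
      using less.prems(2) v by (auto simp: pairwise_insert S_def orthogonal_def inner_commute)
    moreover have "\<And>b. b \<in> insert v B \<Longrightarrow> norm b = 1 \<and> f b = (b \<bullet> f b) *\<^sub>R b"
      using less.prems(3) v by auto
    ultimately obtain C where "insert v B \<subseteq> C" "pairwise orthogonal C" "card C = DIM('a)"
      "\<And>b. b \<in> C \<Longrightarrow> norm b = 1 \<and> f b = (b \<bullet> f b) *\<^sub>R b"
      using less.hyps[of "insert v B"] by metis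
    then show ?thesis using less.prems(1) by blast
  qed
qed

lemma orthonormal_set_span_UNIV:
  fixes B :: "'a::euclidean_space set"
  assumes "pairwise orthogonal B" "\<And>b. b \<in> B \<Longrightarrow> norm b = 1" "card B = DIM('a)"
  shows "finite B" "span B = UNIV"
proof -
  have "0 \<notin> B" using assms(2) by fastforce
  then have "independent B" using assms(1) by (rule pairwise_orthogonal_independent[rotated])
  then show "finite B" "span B = UNIV"
    using assms(3) independent_bound card_eq_dim[of B UNIV] by auto
qed

text \<open>In the basis \<open>B\<close> the map scales each coordinate by a factor of modulus at
  most \<open>q\<close>, and Pythagoras adds up the squares.\<close>

lemma norm_le_of_orthonormal_eigenbasis:
  fixes T :: "'a::euclidean_space \<Rightarrow> 'a"
  assumes B: "pairwise orthogonal B" "\<And>b. b \<in> B \<Longrightarrow> norm b = 1" "card B = DIM('a)"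
    and lin: "linear T" and eig: "\<And>b. b \<in> B \<Longrightarrow> T b = t b *\<^sub>R b"
    and bnd: "\<And>b. b \<in> B \<Longrightarrow> \<bar>t b\<bar> \<le> q"
  shows "norm (T v) \<le> q * norm v"
proof -
  have fin: "finite B" and span: "span B = UNIV" using orthonormal_set_span_UNIV[OF B] by auto
  have exp: "v = (\<Sum>b\<in>B. (v \<bullet> b) *\<^sub>R b)"
    using orthonormal_basis_expand[OF B(1,2) _ fin] span by simp
  have norm2: "(norm (\<Sum>b\<in>B. a b *\<^sub>R b))\<^sup>2 = (\<Sum>b\<in>B. (a b)\<^sup>2)" for a
    using norm_sum_Pythagorean[of B "\<lambda>b. a b *\<^sub>R b"] fin B
    by (auto simp: pairwise_def orthogonal_def)
  have "B \<noteq> {}" using B(3) by auto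
  \<comment> \<open>A Euclidean space has positive dimension, so some \<open>\<bar>t b\<bar>\<close>
    lies below \<open>q\<close>; the sign is needed to pass from squares back to norms.\<close>
  then have q: "q \<ge> 0" using bnd by (meson abs_ge_zero all_not_in_conv order_trans)
  have "T v = (\<Sum>b\<in>B. (v \<bullet> b) *\<^sub>R T b)"
    by (subst exp) (simp add: linear_sum[OF lin] linear_cmul[OF lin])
  also have "\<dots> = (\<Sum>b\<in>B. (t b * (v \<bullet> b)) *\<^sub>R b)" by (simp add: eig mult.commute)
  finally have "(norm (T v))\<^sup>2 = (\<Sum>b\<in>B. (t b * (v \<bullet> b))\<^sup>2)" by (simp add: norm2)
  also have "\<dots> \<le> (\<Sum>b\<in>B. q\<^sup>2 * (v \<bullet> b)\<^sup>2)"
    by (intro sum_mono) (auto simp: power_mult_distrib abs_le_square_iff[symmetric] q bnd intro!: mult_right_mono)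
  also have "\<dots> = (q * norm v)\<^sup>2"
    by (subst (2) exp) (simp only: norm2 power_mult_distrib sum_distrib_left)
  finally show ?thesis using q by (simp add: power2_le_iff_abs_le)
qed

section \<open>Spectrum of symmetric matrices, with multiplicity\<close>

lemma symmetric_matrix_inner:
  fixes A :: "real ^ 'd ^ 'd"
  assumes "transpose A = A"
  shows "(A *v x) \<bullet> y = x \<bullet> (A *v y)"
  by (metis assms dot_lmul_matrix transpose_matrix_vector)

text \<open>Evaluation at \<open>t\<close> is a ring homomorphism, so it passes through the Leibniz
  expansion of the determinant.\<close>

lemma poly_charpoly:
  fixes A :: "real ^ 'd ^ 'd"
  shows "poly (charpoly A) t = det (mat t - A)"
  by (simp add: charpoly_def det_def poly_sum poly_prod map_matrix_def mat_def)
     (intro sum.cong refl arg_cong2[where f="(*)"] prod.cong; simp)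

text \<open>The matrix with columns \<open>B\<close> diagonalizes \<open>A\<close>, so the
  characteristic polynomial splits into the factors of the diagonal. This ties the algebraic
  multiplicities of \<open>eigenvalues\<close> to eigenvectors.\<close>

lemma eigenvalues_orthonormal_eigenbasis:
  fixes A :: "real ^ 'd ^ 'd"
  assumes B: "pairwise orthogonal B" "\<And>b. b \<in> B \<Longrightarrow> norm b = 1" "card B = CARD('d)"
    and eig: "\<And>b. b \<in> B \<Longrightarrow> A *v b = l b *\<^sub>R b"
  shows "eigenvalues A = image_mset l (mset_set B)"
proof -
  have fin: "finite B" using orthonormal_set_span_UNIV[OF B(1,2)] B(3) by simp
  then obtain b :: "'d \<Rightarrow> real ^ 'd" where b: "bij_betw b UNIV B"
    using B(3) bij_betw_iff_card[of "UNIV :: 'd set" B] by auto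
  have bB: "b j \<in> B" for j using b by (auto simp: bij_betw_def)
  have orth: "b i \<bullet> b j = (if i = j then 1 else 0)" for i j
  proof (cases "i = j")
    case True
    then show ?thesis using B(2)[OF bB] by (simp add: dot_square_norm)
  next
    case False
    then have "b i \<noteq> b j" using b by (auto simp: bij_betw_def inj_on_def)
    then show ?thesis using B(1) bB False by (auto simp: pairwise_def orthogonal_def)
  qed
  define Q :: "real ^ 'd ^ 'd" where "Q = (\<chi> i j. b j $ i)"
  have "transpose Q ** Q = mat 1"
    using orth by (simp add: vec_eq_iff matrix_matrix_mult_def transpose_def Q_def mat_def inner_vec_def)
  then have "det Q \<noteq> 0" 
    by (metis det_I det_mul mult_zero_right zero_neq_one)
  have "poly (charpoly A) t = poly (\<Prod>j\<in>UNIV. [:- l (b j), 1:]) t" for t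
  proof -
    define D :: "real ^ 'd ^ 'd" where "D = (\<chi> i j. if i = j then t - l (b j) else 0)"
    \<comment> \<open>Stated without an inverse of \<open>Q\<close>: taking determinants and
      cancelling the nonzero \<open>det Q\<close> is enough.\<close>
    have "(mat t - A) ** Q = Q ** D"
    proof -
      have "((mat t - A) ** Q) $ i $ j = (Q ** D) $ i $ j" for i j
      proof -
        have "((mat t - A) ** Q) $ i $ j = ((mat t - A) *v b j) $ i"
          by (simp add: matrix_matrix_mult_def matrix_vector_mult_def Q_def)
        also have "(mat t - A) *v b j = t *\<^sub>R b j - A *v b j"
          by (simp add: matrix_vector_mult_diff_rdistrib)
             (simp add: vec_eq_iff matrix_vector_mult_def mat_def if_distrib[of "\<lambda>x. x * _"] cong: if_cong)
        also have "\<dots> = (t - l (b j)) *\<^sub>R b j" by (simp add: eig[OF bB] algebra_simps)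
        finally show ?thesis
          by (simp add: matrix_matrix_mult_def Q_def D_def if_distrib[of "\<lambda>x. _ * x"] mult.commute cong: if_cong)
      qed
      then show ?thesis by (simp add: vec_eq_iff)
    qed
    then have "det (mat t - A) = det D"
      using \<open>det Q \<noteq> 0\<close> by (metis det_mul mult.commute mult_left_cancel)
    also have "\<dots> = (\<Prod>j\<in>UNIV. t - l (b j))"
      by (subst det_diagonal) (auto simp: D_def)
    finally show ?thesis by (simp add: poly_charpoly poly_prod)
  qed
  then have "charpoly A = (\<Prod>j\<in>UNIV. [:- l (b j), 1:])"
    using poly_eq_poly_eq_iff by blast
  then have "eigenvalues A = (\<Sum>j\<in>UNIV. {#l (b j)#})"
    by (simp add: eigenvalues_def proots_prod)
  also have "\<dots> = image_mset (l \<circ> b) (mset_set UNIV)"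
    by (simp add: sum_unfold_sum_mset image_mset.compositionality[symmetric] comp_def)
  also have "\<dots> = image_mset l (mset_set B)"
    using b image_mset_mset_set[of b UNIV] by (simp add: bij_betw_def multiset.map_comp[symmetric])
  finally show ?thesis .
qed

text \<open>A full orthonormal eigenbasis accounts for all roots. Hence the sorted list behind
  \<open>eigval\<close> has an entry for every index from 1 to the dimension.\<close>

lemma size_eigenvalues_symmetric:
  fixes A :: "real ^ 'd ^ 'd"
  assumes "transpose A = A"
  shows "size (eigenvalues A) = CARD('d)"
proof -
  obtain C where C: "pairwise orthogonal C" "card C = DIM(real^'d)"
    "\<And>b. b \<in> C \<Longrightarrow> norm b = 1 \<and> A *v b = (b \<bullet> (A *v b)) *\<^sub>R b"
    using selfadjoint_eigenbasis_extend[of "(*v) A" "{}"] symmetric_matrix_inner[OF assms] by auto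
  then have "eigenvalues A = image_mset (\<lambda>b. b \<bullet> (A *v b)) (mset_set C)"
    by (intro eigenvalues_orthonormal_eigenbasis) auto
  then show ?thesis using C by simp
qed

text \<open>The remaining eigenvectors carry the remaining entries of the sorted spectrum, because the
  first \<open>k\<close> entries are, with multiplicity, the eigenvalues of the given eigenvectors.\<close>

lemma extend_lowest_eigenvectors:
  fixes A :: "real ^ 'd ^ 'd"
  assumes sym: "transpose A = A" and k: "k \<le> CARD('d)"
    and eig: "\<And>i. i \<in> {1..k} \<Longrightarrow> A *v u i = eigval A i *\<^sub>R u i"
    and orth: "\<And>i j. i \<in> {1..k} \<Longrightarrow> j \<in> {1..k} \<Longrightarrow> u i \<bullet> u j = (if i = j then 1 else 0)"
  obtains B where "pairwise orthogonal B" "\<And>b. b \<in> B \<Longrightarrow> norm b = 1" "card B = CARD('d)"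
    "u ` {1..k} \<subseteq> B"
    "\<And>b. b \<in> B - u ` {1..k} \<Longrightarrow> \<exists>i\<in>{k+1..CARD('d)}. A *v b = eigval A i *\<^sub>R b"
proof -
  have inj: "inj_on u {1..k}" using orth by (intro inj_onI) (metis zero_neq_one)
  have eig': "norm b = 1 \<and> A *v b = (b \<bullet> (A *v b)) *\<^sub>R b" if b: "b \<in> u ` {1..k}" for b
    using b eig orth by (auto simp: norm_eq_sqrt_inner)
  have "pairwise orthogonal (u ` {1..k})"
    using orth by (auto simp: pairwise_def orthogonal_def)
  then obtain B where B: "u ` {1..k} \<subseteq> B" "pairwise orthogonal B" "card B = DIM(real^'d)"
    and eigB: "\<And>b. b \<in> B \<Longrightarrow> norm b = 1 \<and> A *v b = (b \<bullet> (A *v b)) *\<^sub>R b"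
    using selfadjoint_eigenbasis_extend[of "(*v) A" "u ` {1..k}"] symmetric_matrix_inner[OF sym] eig'
    by (metis matrix_vector_mul_linear)
  define l where "l = (\<lambda>b. b \<bullet> (A *v b))"
  have cB: "card B = CARD('d)" using B(3) by simp
  have fin: "finite B" using cB by (intro card_ge_0_finite) simp
  define xs where "xs = sorted_list_of_multiset (eigenvalues A)"
  have len: "length xs = CARD('d)"
    using size_eigenvalues_symmetric[OF sym] unfolding xs_def
    by (metis mset_sorted_list_of_multiset size_mset)
  \<comment> \<open>List positions start at 0 and \<open>eigval\<close> at 1, hence the shifts by
    \<open>Suc\<close> here and in the witness \<open>Suc (k + j)\<close> below.\<close>
  have nth: "xs ! i = eigval A (Suc i)" for i by (simp add: eigval_def xs_def)
  have l_u: "l (u (Suc i)) = xs ! i" if "i < k" for i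
    using that eig[of "Suc i"] orth[of "Suc i" "Suc i"] by (simp add: l_def nth)
  have "take k xs = map (\<lambda>i. l (u (Suc i))) [0..<k]"
    using len k l_u by (auto intro!: nth_equalityI)
  also have "\<dots> = map (l \<circ> u) [1..<Suc k]"
    by (rule nth_equalityI) (auto simp del: upt_Suc)
  finally have "mset (take k xs) = image_mset (l \<circ> u) (mset_set {1..k})"
    by (simp add: atLeastLessThanSuc_atLeastAtMost[symmetric] del: upt_Suc)
  also have "\<dots> = image_mset l (mset_set (u ` {1..k}))"
    using inj by (simp add: image_mset_mset_set[symmetric] multiset.map_comp)
  finally have take: "mset (take k xs) = image_mset l (mset_set (u ` {1..k}))" .
  have "mset xs = image_mset l (mset_set B)"
    unfolding xs_def using eigB cB B(2)
    by (simp add: l_def eigenvalues_orthonormal_eigenbasis[of B A "\<lambda>b. b \<bullet> (A *v b)"])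
  also have "mset_set B = mset_set (u ` {1..k}) + mset_set (B - u ` {1..k})"
    using B(1) fin by (metis Diff_disjoint Diff_partition finite_Diff finite_subset mset_set_Union)
  also have "mset xs = mset (take k xs) + mset (drop k xs)"
    by (metis append_take_drop_id mset_append)
  \<comment> \<open>Cancelling \<open>take\<close> from both sides as multisets stays correct even
    if one value occurs both before and after position \<open>k\<close>.\<close>
  finally have drop: "mset (drop k xs) = image_mset l (mset_set (B - u ` {1..k}))"
    by (simp add: take)
  show thesis
  proof (rule that[of B])
    fix b assume b: "b \<in> B - u ` {1..k}"
    then have "l b \<in># mset (drop k xs)" using fin by (simp add: drop)
    then obtain j where "j < CARD('d) - k" "l b = xs ! (k + j)"
      using len k by (auto simp: in_set_conv_nth)
    then show "\<exists>i\<in>{k+1..CARD('d)}. A *v b = eigval A i *\<^sub>R b"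
      using b eigB[of b] by (intro bexI[of _ "Suc (k + j)"]) (simp_all add: l_def nth)
  qed (use B eigB cB in auto)
qed

section \<open>Symmetry of the Hessian and the Taylor remainder of the gradient\<close>

lemma has_real_derivative_along_line:
  fixes g :: "'a::real_normed_vector \<Rightarrow> real"
  assumes "(g has_derivative g') (at (p + s *\<^sub>R v))"
  shows "((\<lambda>s. g (p + s *\<^sub>R v)) has_real_derivative g' v) (at s)"
proof -
  have "((\<lambda>s. p + s *\<^sub>R v) has_derivative (\<lambda>h. h *\<^sub>R v)) (at s)"
    by (auto intro!: derivative_eq_intros)
  then have "((\<lambda>s. g (p + s *\<^sub>R v)) has_derivative (\<lambda>h. g' (h *\<^sub>R v))) (at s)"
    using assms by (rule has_derivative_compose)
  moreover have "(\<lambda>h. g' (h *\<^sub>R v)) = (*) (g' v)"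
    using has_derivative_linear[OF assms] by (auto simp: linear_cmul)
  ultimately show ?thesis by (simp add: has_field_derivative_def)
qed

text \<open>Two uses of the mean value theorem, first along \<open>a\<close>, then along
  \<open>b\<close>. The second difference on the left is symmetric in \<open>a\<close> and
  \<open>b\<close>, while the right side differentiates in a fixed order.\<close>

lemma second_difference_mvt:
  fixes f :: "'a::real_normed_vector \<Rightarrow> real"
  assumes f: "\<And>x. (f has_derivative f' x) (at x)"
    and fa: "\<And>x. ((\<lambda>x. f' x a) has_derivative fa x) (at x)"
    and t: "0 < t"
  shows "\<exists>\<xi> \<eta>. 0 < \<xi> \<and> \<xi> < t \<and> 0 < \<eta> \<and> \<eta> < t \<and>
    f (x + t *\<^sub>R a + t *\<^sub>R b) - f (x + t *\<^sub>R a) - f (x + t *\<^sub>R b) + f x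
      = t\<^sup>2 * fa (x + \<xi> *\<^sub>R a + \<eta> *\<^sub>R b) b"
proof -
  \<comment> \<open>The increment in direction \<open>b\<close> as a function of the displacement
    along \<open>a\<close>; its own increment over \<open>[0, t]\<close> is the second
    difference.\<close>
  define \<phi> where "\<phi> s = f (x + t *\<^sub>R b + s *\<^sub>R a) - f (x + s *\<^sub>R a)" for s
  have "(\<phi> has_real_derivative f' (x + t *\<^sub>R b + s *\<^sub>R a) a - f' (x + s *\<^sub>R a) a) (at s)" for s
    unfolding \<phi>_def by (intro DERIV_diff has_real_derivative_along_line f)
  then obtain \<xi> where \<xi>: "0 < \<xi>" "\<xi> < t"
    "\<phi> t - \<phi> 0 = t * (f' (x + t *\<^sub>R b + \<xi> *\<^sub>R a) a - f' (x + \<xi> *\<^sub>R a) a)"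
    using MVT2[OF t, of \<phi> "\<lambda>s. f' (x + t *\<^sub>R b + s *\<^sub>R a) a - f' (x + s *\<^sub>R a) a"] by auto
  have "((\<lambda>s. f' (x + \<xi> *\<^sub>R a + s *\<^sub>R b) a) has_real_derivative fa (x + \<xi> *\<^sub>R a + s *\<^sub>R b) b) (at s)"
    for s by (rule has_real_derivative_along_line[OF fa])
  then obtain \<eta> where \<eta>: "0 < \<eta>" "\<eta> < t"
    "f' (x + \<xi> *\<^sub>R a + t *\<^sub>R b) a - f' (x + \<xi> *\<^sub>R a) a = t * fa (x + \<xi> *\<^sub>R a + \<eta> *\<^sub>R b) b"
    using MVT2[OF t, of "\<lambda>s. f' (x + \<xi> *\<^sub>R a + s *\<^sub>R b) a" "\<lambda>s. fa (x + \<xi> *\<^sub>R a + s *\<^sub>R b) b"] by auto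
  have "\<phi> t - \<phi> 0 = t\<^sup>2 * fa (x + \<xi> *\<^sub>R a + \<eta> *\<^sub>R b) b"
    using \<xi>(3) \<eta>(3) by (simp add: power2_eq_square add.commute add.left_commute)
  then show ?thesis using \<xi> \<eta> by (intro exI[of _ \<xi>] exI[of _ \<eta>]) (simp add: \<phi>_def algebra_simps)
qed

text \<open>Schwarz's theorem: both orders of differentiation represent the same second difference
  at points close to \<open>x\<close>, and continuity at \<open>x\<close> transfers the
  equality.\<close>

lemma mixed_second_derivatives_eq:
  fixes f :: "'a::real_normed_vector \<Rightarrow> real"
  assumes f: "\<And>x. (f has_derivative f' x) (at x)"
    and fa: "\<And>x. ((\<lambda>x. f' x a) has_derivative fa x) (at x)"
    and fb: "\<And>x. ((\<lambda>x. f' x b) has_derivative fb x) (at x)"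
    and ca: "isCont (\<lambda>x. fa x b) x" and cb: "isCont (\<lambda>x. fb x a) x"
  shows "fa x b = fb x a"
proof (rule ccontr)
  assume ne: "fa x b \<noteq> fb x a"
  \<comment> \<open>Half the gap: two errors below \<open>e\<close> cannot bridge it.\<close>
  define e where "e = \<bar>fa x b - fb x a\<bar> / 2"
  have e: "e > 0" using ne by (simp add: e_def)
  obtain d1 where d1: "d1 > 0" "\<And>y. dist y x < d1 \<Longrightarrow> \<bar>fa y b - fa x b\<bar> < e"
    using ca e unfolding continuous_at_eps_delta dist_real_def by metis
  obtain d2 where d2: "d2 > 0" "\<And>y. dist y x < d2 \<Longrightarrow> \<bar>fb y a - fb x a\<bar> < e"
    using cb e unfolding continuous_at_eps_delta dist_real_def by metis
  \<comment> \<open>Intermediate points lie within \<open>t * (norm a + norm b)\<close> of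
    \<open>x\<close>. The summand 1 makes \<open>c\<close> positive and this bound strictly smaller
    than \<open>t * c = min d1 d2\<close>.\<close>
  define c where "c = norm a + norm b + 1"
  have c: "c > 0" unfolding c_def by (simp add: add_nonneg_pos)
  define t where "t = min d1 d2 / c"
  have t: "t > 0" using d1 d2 c by (simp add: t_def)
  have near: "dist (x + \<xi> *\<^sub>R v + \<eta> *\<^sub>R w) x < min d1 d2"
    if "0 < \<xi>" "\<xi> < t" "0 < \<eta>" "\<eta> < t" "norm v + norm w < c" for \<xi> \<eta> v w
  proof -
    have "dist (x + \<xi> *\<^sub>R v + \<eta> *\<^sub>R w) x \<le> \<xi> * norm v + \<eta> * norm w"
      using that norm_triangle_ineq[of "\<xi> *\<^sub>R v" "\<eta> *\<^sub>R w"] by (simp add: dist_norm add.assoc)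
    also have "\<dots> \<le> t * norm v + t * norm w"
      using that by (intro add_mono mult_right_mono) auto
    also have "\<dots> = t * (norm v + norm w)" by (simp add: distrib_left)
    also have "\<dots> < t * c" using that t by simp
    finally show ?thesis using c by (simp add: t_def)
  qed
  obtain \<xi> \<eta> where 1: "0 < \<xi>" "\<xi> < t" "0 < \<eta>" "\<eta> < t"
    "f (x + t *\<^sub>R a + t *\<^sub>R b) - f (x + t *\<^sub>R a) - f (x + t *\<^sub>R b) + f x
      = t\<^sup>2 * fa (x + \<xi> *\<^sub>R a + \<eta> *\<^sub>R b) b"
    using second_difference_mvt[OF f fa t] by blast
  obtain \<xi>' \<eta>' where 2: "0 < \<xi>'" "\<xi>' < t" "0 < \<eta>'" "\<eta>' < t"
    "f (x + t *\<^sub>R b + t *\<^sub>R a) - f (x + t *\<^sub>R b) - f (x + t *\<^sub>R a) + f x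
      = t\<^sup>2 * fb (x + \<xi>' *\<^sub>R b + \<eta>' *\<^sub>R a) a"
    using second_difference_mvt[OF f fb t] by blast
  have swap: "x + t *\<^sub>R b + t *\<^sub>R a = x + t *\<^sub>R a + t *\<^sub>R b" by simp
  have "t\<^sup>2 * fa (x + \<xi> *\<^sub>R a + \<eta> *\<^sub>R b) b = t\<^sup>2 * fb (x + \<xi>' *\<^sub>R b + \<eta>' *\<^sub>R a) a"
    using 1(5) 2(5)[unfolded swap] by linarith
  then have "fa (x + \<xi> *\<^sub>R a + \<eta> *\<^sub>R b) b = fb (x + \<xi>' *\<^sub>R b + \<eta>' *\<^sub>R a) a"
    using t by simp
  moreover have "\<bar>fa (x + \<xi> *\<^sub>R a + \<eta> *\<^sub>R b) b - fa x b\<bar> < e"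
    using near[OF 1(1-4), of a b] d1(2) by (simp add: c_def)
  moreover have "\<bar>fb (x + \<xi>' *\<^sub>R b + \<eta>' *\<^sub>R a) a - fb x a\<bar> < e"
    using near[OF 2(1-4), of b a] d2(2) by (simp add: c_def)
  ultimately show False unfolding e_def by argo
qed

lemma C_k_mono: "C_k (Suc m) f \<Longrightarrow> C_k m f"
  by (induction m arbitrary: f) (auto intro: differentiable_imp_continuous_on)

text \<open>\<open>hessian\<close> is a Jacobian and represents the derivative only once
  \<open>grad f\<close> is differentiable, which holds componentwise.\<close>

lemma grad_has_derivative:
  fixes f :: "real ^ 'd \<Rightarrow> real"
  assumes "C_k 2 f"
  shows "(grad f has_derivative (\<lambda>h. hessian f x *v h)) (at x)"
proof -
  have "\<forall>i. (\<lambda>x. frechet_derivative f (at x) (axis i 1)) differentiable at x"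
    using assms by (simp add: numeral_2_eq_2 differentiable_on_def)
  then have "grad f differentiable at x"
    by (auto simp: differentiable_componentwise_within[of "grad f" x UNIV] grad_def Basis_vec_def
        inner_axis)
  then show ?thesis unfolding hessian_def by (simp add: jacobian_works)
qed

lemma hessian_nth:
  fixes f :: "real ^ 'd \<Rightarrow> real"
  assumes "C_k 2 f"
  shows "hessian f x $ i $ j =
    frechet_derivative (\<lambda>y. frechet_derivative f (at y) (axis i 1)) (at x) (axis j 1)"
proof -
  have "((\<lambda>y. grad f y $ i) has_derivative (\<lambda>h. (hessian f x *v h) $ i)) (at x)"
    using bounded_linear.has_derivative[OF bounded_linear_vec_nth grad_has_derivative[OF assms]] .
  then have "(\<lambda>h. (hessian f x *v h) $ i) =
      frechet_derivative (\<lambda>y. frechet_derivative f (at y) (axis i 1)) (at x)"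
    by (intro frechet_derivative_at) (simp add: grad_def)
  moreover have "(hessian f x *v axis j 1) $ i = hessian f x $ i $ j"
    by (simp add: matrix_vector_mult_basis column_def)
  ultimately show ?thesis by metis
qed

text \<open>Third-order smoothness makes the second partial derivatives differentiable, hence
  continuous, so Schwarz's theorem applies to each entry.\<close>

lemma hessian_symmetric:
  fixes f :: "real ^ 'd \<Rightarrow> real"
  assumes "C_k 3 f"
  shows "transpose (hessian f x) = hessian f x"
proof -
  let ?G = "\<lambda>i y. frechet_derivative f (at y) (axis i 1)"
  have C: "f differentiable_on UNIV" "\<And>i. ?G i differentiable_on UNIV"
    "\<And>i j. (\<lambda>y. frechet_derivative (?G i) (at y) (axis j 1)) differentiable_on UNIV"
    using assms by (auto simp: numeral_3_eq_3)
  have C2: "C_k 2 f" using assms C_k_mono[of 2 f] by (simp only: Suc_numeral semiring_norm)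
  have cont: "isCont (\<lambda>y. frechet_derivative (?G i) (at y) (axis j 1)) x" for i j
    using C(3)[of i j] by (intro differentiable_imp_continuous_within) (simp add: differentiable_on_def)
  have "hessian f x $ i $ j = hessian f x $ j $ i" for i j
    unfolding hessian_nth[OF C2]
  proof (rule mixed_second_derivatives_eq[where f = f and f' = "\<lambda>y. frechet_derivative f (at y)"
        and fa = "\<lambda>y. frechet_derivative (?G i) (at y)" and fb = "\<lambda>y. frechet_derivative (?G j) (at y)"])
  qed (use C(1,2) cont in \<open>simp_all add: differentiable_on_def frechet_derivative_works[symmetric]\<close>)
  then show ?thesis by (simp add: vec_eq_iff transpose_def)
qed

lemma norm_mult_le_op_norm: "norm (A *v v) \<le> op_norm A * norm v"
  unfolding op_norm_def by (rule onorm) (rule matrix_vector_mul_bounded_linear)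

text \<open>Along the segment from \<open>p\<close> to \<open>y\<close> the Hessian differs from its
  value at \<open>y\<close> by at most \<open>M * (1 - t) * norm (y - p)\<close>; integrating over
  \<open>t\<close> yields the factor 1/2. The expansion uses the Hessian at \<open>y\<close> because
  the preconditioner is built from the Hessian at the current iterate.\<close>

lemma grad_taylor_remainder:
  fixes f :: "real ^ 'd \<Rightarrow> real"
  assumes C2: "C_k 2 f" and M: "M \<ge> 0" and y: "y \<in> ball p \<delta>"
    and lip: "\<And>y z. y \<in> ball p \<delta> \<Longrightarrow> z \<in> ball p \<delta> \<Longrightarrow>
      op_norm (hessian f y - hessian f z) \<le> M * norm (y - z)"
  shows "norm (hessian f y *v (y - p) - (grad f y - grad f p)) \<le> M / 2 * (norm (y - p))\<^sup>2"
proof -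
  define e where "e = y - p"
  define A where "A = hessian f y"
  define F where "F t = grad f (p + t *\<^sub>R e) - t *\<^sub>R (A *v e)" for t
  define c where "c = M * (norm e)\<^sup>2"
  have F': "(F has_vector_derivative (hessian f (p + t *\<^sub>R e) - A) *v e) (at t)" for t
  proof -
    have "((\<lambda>t. p + t *\<^sub>R e) has_vector_derivative e) (at t)"
      by (auto intro!: derivative_eq_intros)
    then have "((\<lambda>t. grad f (p + t *\<^sub>R e)) has_vector_derivative hessian f (p + t *\<^sub>R e) *v e) (at t)"
      using vector_derivative_diff_chain_within[OF _ has_derivative_at_withinI[OF grad_has_derivative[OF C2]], of "\<lambda>t. p + t *\<^sub>R e" e t UNIV]
      by (simp add: comp_def)
    then show ?thesis unfolding F_def
      by (auto intro!: derivative_eq_intros simp: matrix_vector_mult_diff_rdistrib)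
  qed
  have "norm (F 1 - F 0) \<le> c * (1 - 1\<^sup>2 / 2) - c * (0 - 0\<^sup>2 / 2)"
  \<comment> \<open>The majorant is the antiderivative of \<open>c * (1 - t)\<close> that vanishes
    at 0; its value at 1 is \<open>c / 2\<close>.\<close>
  proof (rule differentiable_bound_general[where f' = "\<lambda>t. (hessian f (p + t *\<^sub>R e) - A) *v e"
        and \<phi> = "\<lambda>t. c * (t - t\<^sup>2 / 2)" and \<phi>' = "\<lambda>t. c * (1 - t)"])
    show "continuous_on {0..1} F"
      using F' by (meson continuous_at_imp_continuous_on has_vector_derivative_continuous)
    show "((\<lambda>t. c * (t - t\<^sup>2 / 2)) has_vector_derivative c * (1 - t)) (at t)" for t
      by (auto intro!: derivative_eq_intros simp: has_real_derivative_iff_has_vector_derivative[symmetric])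
    show "norm ((hessian f (p + t *\<^sub>R e) - A) *v e) \<le> c * (1 - t)" if "0 < t" "t < 1" for t
    proof -
      have "t * norm e \<le> norm e" using that by (simp add: mult_left_le_one_le)
      then have "p + t *\<^sub>R e \<in> ball p \<delta>" using y that by (simp add: dist_norm e_def norm_minus_commute)
      then have "op_norm (hessian f (p + t *\<^sub>R e) - A) \<le> M * norm (p + t *\<^sub>R e - y)"
        unfolding A_def using y by (rule lip)
      also have "p + t *\<^sub>R e - y = (t - 1) *\<^sub>R e" by (simp add: e_def algebra_simps)
      also have "M * norm \<dots> = M * (1 - t) * norm e" using that by simp
      finally have "op_norm (hessian f (p + t *\<^sub>R e) - A) * norm e \<le> M * (1 - t) * norm e * norm e"
        by (rule mult_right_mono) simp
      then show ?thesis
        using norm_mult_le_op_norm[of "hessian f (p + t *\<^sub>R e) - A" e]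
        by (simp add: c_def power2_eq_square mult_ac)
    qed
  qed (auto intro!: continuous_intros F')
  then have "norm (F 0 - F 1) \<le> c / 2" by (simp add: norm_minus_commute)
  then show ?thesis by (simp add: F_def A_def c_def e_def algebra_simps)
qed

section \<open>The preconditioner in a common eigenbasis with the Hessian\<close>

lemma outer_mult_vector: "outer a b *v w = (b \<bullet> w) *\<^sub>R a"
  by (simp add: vec_eq_iff outer_def matrix_vector_mult_def inner_vec_def sum_distrib_left
      sum_distrib_right mult_ac)

lemma sum_matrix_vector_mult:
  fixes g :: "'i \<Rightarrow> real ^ 'd ^ 'e"
  shows "(\<Sum>i\<in>I. g i) *v w = (\<Sum>i\<in>I. g i *v w)"
  using sum_comp_morphism[of "\<lambda>M. M *v w" g I] by (simp add: comp_def matrix_vector_mult_add_rdistrib)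

lemma preconditioner_apply:
  "(mat 1 - (\<Sum>i=1..k. c i *\<^sub>R outer (u i) (u i))) *v w = w - (\<Sum>i=1..k. (c i * (u i \<bullet> w)) *\<^sub>R u i)"
  by (simp add: matrix_vector_mult_diff_rdistrib sum_matrix_vector_mult outer_mult_vector
      flip: scaleR_matrix_vector_assoc)

context
  fixes A P :: "real ^ 'd ^ 'd" and u :: "nat \<Rightarrow> real ^ 'd" and k :: nat and \<epsilon> \<mu> L :: real
  assumes sym: "transpose A = A" and k: "k \<le> CARD('d)"
    and pos: "0 < \<epsilon>" "\<epsilon> < \<mu>" "\<mu> < L"
    and neg_part: "\<And>i. i \<in> {1..k} \<Longrightarrow> eigval A i < 0 \<and> \<bar>eigval A i\<bar> \<in> {\<epsilon>..L}"
    and pos_part: "\<And>i. i \<in> {k+1..CARD('d)} \<Longrightarrow> 0 < eigval A i \<and> \<bar>eigval A i\<bar> \<in> {\<mu>..L}"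
    and eig: "\<And>i. i \<in> {1..k} \<Longrightarrow> A *v u i = eigval A i *\<^sub>R u i"
    and orth: "\<And>i j. i \<in> {1..k} \<Longrightarrow> j \<in> {1..k} \<Longrightarrow> u i \<bullet> u j = (if i = j then 1 else 0)"
    and P: "P = mat 1 - (\<Sum>i=1..k. (1 + \<mu> / \<bar>eigval A i\<bar>) *\<^sub>R outer (u i) (u i))"
begin

text \<open>Orthonormality leaves one summand, and
  \<open>1 - (1 + \<mu> / \<bar>eigval A j\<bar>)\<close> is the factor. Since
  \<open>eigval A j\<close> is negative, its product with this factor is exactly
  \<open>\<mu>\<close>.\<close>

lemma preconditioner_eigenvector:
  assumes "j \<in> {1..k}"
  shows "P *v u j = (- \<mu> / \<bar>eigval A j\<bar>) *\<^sub>R u j"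
proof -
  have "(\<Sum>i=1..k. ((1 + \<mu> / \<bar>eigval A i\<bar>) * (u i \<bullet> u j)) *\<^sub>R u i)
      = (\<Sum>i=1..k. if i = j then (1 + \<mu> / \<bar>eigval A j\<bar>) *\<^sub>R u j else 0)"
    using assms orth by (intro sum.cong) auto
  also have "\<dots> = (1 + \<mu> / \<bar>eigval A j\<bar>) *\<^sub>R u j" using assms by simp
  finally show ?thesis unfolding P preconditioner_apply by (simp add: algebra_simps)
qed

lemma preconditioner_orthogonal:
  assumes "\<And>i. i \<in> {1..k} \<Longrightarrow> u i \<bullet> b = 0"
  shows "P *v b = b"
  unfolding P preconditioner_apply using assms by simp

text \<open>On \<open>u j\<close> the product \<open>p * a\<close> equals \<open>\<mu>\<close>, and
  \<open>\<bar>p\<bar> \<le> \<mu> / \<epsilon>\<close> because the eigenvalue has modulus at least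
  \<open>\<epsilon>\<close>. On the other basis vectors \<open>p = 1\<close>, so
  \<open>p * a\<close> is a positive eigenvalue of \<open>A\<close>, and
  \<open>1 \<le> \<mu> / \<epsilon>\<close> follows from \<open>\<epsilon> < \<mu>\<close>.\<close>

lemma common_eigenbasis:
  obtains B where "pairwise orthogonal B" "\<And>b. b \<in> B \<Longrightarrow> norm b = 1" "card B = CARD('d)"
    "\<And>b. b \<in> B \<Longrightarrow> \<exists>p a. P *v b = p *\<^sub>R b \<and> A *v b = a *\<^sub>R b \<and>
      \<bar>p\<bar> \<le> \<mu> / \<epsilon> \<and> \<mu> \<le> p * a \<and> p * a \<le> L"
proof -
  obtain B where B: "pairwise orthogonal B" "\<And>b. b \<in> B \<Longrightarrow> norm b = 1" "card B = CARD('d)"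
    and uB: "u ` {1..k} \<subseteq> B"
    and rest: "\<And>b. b \<in> B - u ` {1..k} \<Longrightarrow> \<exists>i\<in>{k+1..CARD('d)}. A *v b = eigval A i *\<^sub>R b"
    using extend_lowest_eigenvectors[OF sym k eig orth] by metis
  have "\<exists>p a. P *v b = p *\<^sub>R b \<and> A *v b = a *\<^sub>R b \<and> \<bar>p\<bar> \<le> \<mu> / \<epsilon> \<and> \<mu> \<le> p * a \<and> p * a \<le> L"
    if b: "b \<in> B" for b
  proof (cases "b \<in> u ` {1..k}")
    case True
    then obtain j where j: "j \<in> {1..k}" "b = u j" by auto
    have "\<mu> / \<bar>eigval A j\<bar> \<le> \<mu> / \<epsilon>"
      using neg_part[OF j(1)] pos by (intro frac_le) auto
    then show ?thesis
      using preconditioner_eigenvector[OF j(1)] eig[OF j(1)] neg_part[OF j(1)] pos j(2)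
      by (intro exI[of _ "- \<mu> / \<bar>eigval A j\<bar>"] exI[of _ "eigval A j"]) auto
  next
    case False
    then obtain i where i: "i \<in> {k+1..CARD('d)}" "A *v b = eigval A i *\<^sub>R b" using rest b by blast
    have "u j \<bullet> b = 0" if "j \<in> {1..k}" for j
    proof -
      have "u j \<in> B" "u j \<noteq> b" using uB False that by auto
      then show ?thesis using B(1) b by (simp add: pairwise_def orthogonal_def)
    qed
    then have "P *v b = b" by (rule preconditioner_orthogonal)
    then show ?thesis
      using i(2) pos_part[OF i(1)] pos by (intro exI[of _ 1] exI[of _ "eigval A i"]) auto
  qed
  then show thesis using that B by blast
qed

lemma norm_preconditioner_le: "norm (P *v w) \<le> \<mu> / \<epsilon> * norm w"
proof -
  obtain B where B: "pairwise orthogonal B" "\<And>b. b \<in> B \<Longrightarrow> norm b = 1" "card B = CARD('d)"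
    and eigs: "\<And>b. b \<in> B \<Longrightarrow> \<exists>p. P *v b = p *\<^sub>R b \<and> \<bar>p\<bar> \<le> \<mu> / \<epsilon>"
    using common_eigenbasis by metis
  then obtain p where "\<And>b. b \<in> B \<Longrightarrow> P *v b = p b *\<^sub>R b \<and> \<bar>p b\<bar> \<le> \<mu> / \<epsilon>" by metis
  then show ?thesis
    using norm_le_of_orthonormal_eigenbasis[of B "(*v) P" p "\<mu> / \<epsilon>"] B by simp
qed

text \<open>The eigenvalues \<open>p * a\<close> of the preconditioned Hessian fill at most
  \<open>[\<mu>, L]\<close>. The step size \<open>2 / (L + \<mu>)\<close> balances the ends:
  \<open>1 - 2 / (L + \<mu>) * s\<close> takes the values
  \<open>\<plusminus> (L - \<mu>) / (L + \<mu>)\<close> at \<open>s = \<mu>\<close> and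
  \<open>s = L\<close>.\<close>

lemma norm_linearized_step_le:
  "norm (v - (2 / (L + \<mu>)) *\<^sub>R (P *v (A *v v))) \<le> (L - \<mu>) / (L + \<mu>) * norm v"
proof -
  let ?T = "\<lambda>v. v - (2 / (L + \<mu>)) *\<^sub>R (P *v (A *v v))"
  obtain B where B: "pairwise orthogonal B" "\<And>b. b \<in> B \<Longrightarrow> norm b = 1" "card B = CARD('d)"
    and eigs: "\<And>b. b \<in> B \<Longrightarrow> \<exists>p a. P *v b = p *\<^sub>R b \<and> A *v b = a *\<^sub>R b \<and>
      \<bar>p\<bar> \<le> \<mu> / \<epsilon> \<and> \<mu> \<le> p * a \<and> p * a \<le> L"
    using common_eigenbasis by metis
  have "\<exists>t. ?T b = t *\<^sub>R b \<and> \<bar>t\<bar> \<le> (L - \<mu>) / (L + \<mu>)" if b: "b \<in> B" for b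
  proof -
    obtain p a where pa: "P *v b = p *\<^sub>R b" "A *v b = a *\<^sub>R b" "\<mu> \<le> p * a" "p * a \<le> L"
      using eigs[OF b] by blast
    have "?T b = (1 - 2 / (L + \<mu>) * (p * a)) *\<^sub>R b"
      by (simp add: pa matrix_vector_mult_scaleR algebra_simps)
    moreover have "1 - 2 / (L + \<mu>) * (p * a) = (L + \<mu> - 2 * (p * a)) / (L + \<mu>)"
      using pos by (simp add: field_simps)
    moreover have "\<bar>(L + \<mu> - 2 * (p * a)) / (L + \<mu>)\<bar> \<le> (L - \<mu>) / (L + \<mu>)"
      using pos pa(3,4) by (simp add: abs_le_iff divide_right_mono flip: minus_divide_left)
    ultimately show ?thesis by metis
  qed
  then obtain t where "\<And>b. b \<in> B \<Longrightarrow> ?T b = t b *\<^sub>R b \<and> \<bar>t b\<bar> \<le> (L - \<mu>) / (L + \<mu>)" by metis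
  moreover have "linear ?T"
    by (intro linearI) (simp_all add: matrix_vector_right_distrib matrix_vector_mult_scaleR algebra_simps)
  ultimately show ?thesis
    using norm_le_of_orthonormal_eigenbasis[of B ?T t "(L - \<mu>) / (L + \<mu>)"] B by simp
qed

end

section \<open>The scalar error recursion\<close>

text \<open>The map \<open>r \<mapsto> R * r / (R - r)\<close> linearizes the recursion: in terms of \<open>1 / r - 1 / R\<close> a step
  multiplies by at least \<open>1 + q\<close>.\<close>

lemma quadratic_recursion_step:
  fixes r r' q R :: real
  assumes r: "0 \<le> r" "r < R" and q: "0 \<le> q" and r': "r' \<le> (1 - q) * r + q * r\<^sup>2 / R"
  shows "r' \<le> r" "R * r' / (R - r') \<le> R * r / (R - r) / (1 + q)"
proof -
  have R: "R > 0" using r by simp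
  have bound: "(1 - q) * r + q * r\<^sup>2 / R = r * (R - q * (R - r)) / R"
    using R by (simp add: field_simps power2_eq_square)
  also have "\<dots> \<le> r * R / R"
    using r q R by (intro divide_right_mono mult_left_mono) auto
  finally show "r' \<le> r" using r' R by simp
  have pos: "0 < (1 + q) * (R - r)" "0 < R - r'" using r q \<open>r' \<le> r\<close> by auto
  \<comment> \<open>The extra factor completes a difference of squares,
    \<open>(R - s) * (R + s) \<le> R\<^sup>2\<close> with \<open>s = q * (R - r)\<close>. The result
    \<open>r' * (R + s) \<le> r * R\<close> is the cross-multiplied claim.\<close>
  have "r' * (R + q * (R - r)) \<le> r * (R - q * (R - r)) / R * (R + q * (R - r))"
    using r q R r' bound by (intro mult_right_mono) auto
  also have "\<dots> = r * (R\<^sup>2 - (q * (R - r))\<^sup>2) / R" by (simp add: power2_eq_square algebra_simps)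
  also have "\<dots> \<le> r * R\<^sup>2 / R" using r R by (intro divide_right_mono mult_left_mono) auto
  also have "\<dots> = r * R" using R by (simp add: power2_eq_square)
  finally have "R * (r' * ((1 + q) * (R - r))) \<le> R * (r * (R - r'))"
    using R by (intro mult_left_mono) (auto simp: algebra_simps)
  then show "R * r' / (R - r') \<le> R * r / (R - r) / (1 + q)"
    using pos by (simp add: divide_le_eq le_divide_eq mult_ac) 
qed

text \<open>The transformed error contracts in every step and dominates \<open>r n\<close>, since
  \<open>R / (R - r n) \<ge> 1\<close>.\<close>

lemma quadratic_recursion_rate:
  fixes r :: "nat \<Rightarrow> real"
  assumes nonneg: "\<And>n. 0 \<le> r n" and r0: "r 0 < R" and q: "0 \<le> q"
    and rec: "\<And>n. r n \<le> r 0 \<Longrightarrow> r (Suc n) \<le> (1 - q) * r n + q * (r n)\<^sup>2 / R"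
  shows "r n \<le> (1 / (1 + q)) ^ n * (R * r 0 / (R - r 0))"
proof -
  \<comment> \<open>Both facts must be carried together: \<open>rec\<close> is available only while
    \<open>r n \<le> r 0\<close>.\<close>
  have main: "r n \<le> r 0 \<and> R * r n / (R - r n) \<le> (1 / (1 + q)) ^ n * (R * r 0 / (R - r 0))" for n
  proof (induction n)
    case (Suc n)
    have lt: "r n < R" using Suc r0 by simp
    note step = quadratic_recursion_step[OF nonneg lt q rec]
    have "R * r (Suc n) / (R - r (Suc n)) \<le> R * r n / (R - r n) / (1 + q)" using step(2) Suc by simp
    also have "\<dots> \<le> (1 / (1 + q)) ^ n * (R * r 0 / (R - r 0)) / (1 + q)"
      using Suc q by (intro divide_right_mono) auto
    also have "\<dots> = (1 / (1 + q)) ^ Suc n * (R * r 0 / (R - r 0))" by simp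
    finally show ?case using step(1) Suc by auto
  qed simp
  have "r n < R" using main[of n] r0 by simp
  have "r n \<le> R * r n / (R - r n)"
    using \<open>r n < R\<close> nonneg[of n] by (simp add: le_divide_eq algebra_simps)
  then show ?thesis using main[of n] by linarith
qed

section \<open>Convergence of the iteration to the saddle point\<close>

theorem theorem4p4:
  fixes E :: "real ^ 'd \<Rightarrow> real"
    and xstar :: "real ^ 'd"
    and k :: nat
    and \<delta> M \<epsilon> \<mu> L r0 rhat \<kappa> :: real
    and x :: "nat \<Rightarrow> real ^ 'd"
    and \<beta> \<eta> :: "nat \<Rightarrow> real"
    and lam :: "nat \<Rightarrow> nat \<Rightarrow> real"
    and u :: "nat \<Rightarrow> nat \<Rightarrow> real ^ 'd"
  assumes C3: "C_k 3 E"
    and saddle: "index_saddle k E xstar"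
    and delta_pos: "\<delta> > 0"
    and M_pos: "M > 0"
    and lipschitz: "\<forall>y\<in>ball xstar \<delta>. \<forall>z\<in>ball xstar \<delta>.
      op_norm (hessian E y - hessian E z) \<le> M * norm (y - z)"
    and eps_mu_L: "0 < \<epsilon>" "\<epsilon> < \<mu>" "\<mu> < L"
    and spectrum_neg: "\<forall>y\<in>ball xstar \<delta>. \<forall>i\<in>{1..k}.
      eigval (hessian E y) i < 0 \<and> \<bar>eigval (hessian E y) i\<bar> \<in> {\<epsilon>..L}"
    and spectrum_pos: "\<forall>y\<in>ball xstar \<delta>. \<forall>i\<in>{k+1..CARD('d)}.
      0 < eigval (hessian E y) i \<and> \<bar>eigval (hessian E y) i\<bar> \<in> {\<mu>..L}"
    and r0: "r0 = norm (x 0 - xstar)"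
    and rhat: "rhat = 2 * \<epsilon> / M"
    and init: "r0 < min \<delta> rhat"
    and lam: "\<forall>n. \<forall>i\<in>{1..k}. lam n i = eigval (hessian E (x n)) i"
    and eigvec: "\<forall>n. \<forall>i\<in>{1..k}. hessian E (x n) *v u n i = lam n i *\<^sub>R u n i"
    and orthonormal: "\<forall>n. \<forall>i\<in>{1..k}. \<forall>j\<in>{1..k}.
      u n i \<bullet> u n j = (if i = j then 1 else 0)"
    and beta: "\<forall>n. \<beta> n = 2 / (L + \<mu>)"
    and eta: "\<forall>n. \<eta> n = \<mu>"
    and step: "\<forall>n. x (Suc n) = x n - \<beta> n *\<^sub>R
      ((mat 1 - (\<Sum>i=1..k. (1 + \<eta> n / \<bar>lam n i\<bar>) *\<^sub>R outer (u n i) (u n i))) *v grad E (x n))"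
    and kappa: "\<kappa> = L / \<mu>"
  shows "x \<longlonglongrightarrow> xstar \<and>
    (\<forall>n. norm (x n - xstar) \<le> (1 - 2 / (\<kappa> + 3)) ^ n * (rhat * r0 / (rhat - r0)))"
proof -
  define r where "r n = norm (x n - xstar)" for n
  \<comment> \<open>Chosen so that \<open>1 - q\<close> is the linear contraction factor
    \<open>(L - \<mu>) / (L + \<mu>)\<close>.\<close>
  define q where "q = 2 * \<mu> / (L + \<mu>)"
  have pos: "0 < \<epsilon>" "0 < \<mu>" "0 < L" "0 < L + \<mu>" using eps_mu_L by auto
  have C2: "C_k 2 E" using C3 C_k_mono[of 2 E] by (simp only: Suc_numeral semiring_norm)
  have sym: "transpose (hessian E y) = hessian E y" for y by (rule hessian_symmetric[OF C3])
  \<comment> \<open>The index counts some of the eigenvalues at \<open>xstar\<close>, of which there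
    are \<open>CARD('d)\<close> in total.\<close>
  have k: "k \<le> CARD('d)"
    using saddle size_filter_mset_lesseq[of "\<lambda>l. l < 0" "eigenvalues (hessian E xstar)"]
    by (auto simp: index_saddle_def size_eigenvalues_symmetric[OF sym])
  have r00: "r 0 = r0" by (simp add: r_def r0)
  have rhat_pos: "rhat > 0" using pos M_pos by (simp add: rhat)
  \<comment> \<open>The condition \<open>r n \<le> r 0\<close> keeps the iterate in the ball on
    which the spectral and Lipschitz bounds hold.\<close>
  have rec: "r (Suc n) \<le> (1 - q) * r n + q * (r n)\<^sup>2 / rhat" if "r n \<le> r 0" for n
  proof -
    have xn: "x n \<in> ball xstar \<delta>"
      using that init r00 by (simp add: r_def dist_norm norm_minus_commute)
    define e where "e = x n - xstar"
    define A where "A = hessian E (x n)"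
    define P where "P = mat 1 - (\<Sum>i=1..k. (1 + \<mu> / \<bar>eigval A i\<bar>) *\<^sub>R outer (u n i) (u n i))"
    define w where "w = A *v e - grad E (x n)"
    note setting = sym[of "x n", folded A_def] k eps_mu_L
      spectrum_neg[rule_format, OF xn, folded A_def] spectrum_pos[rule_format, OF xn, folded A_def]
    have eig: "A *v u n i = eigval A i *\<^sub>R u n i" if "i \<in> {1..k}" for i
      using eigvec lam that by (simp add: A_def)
    have lin: "norm (e - (2 / (L + \<mu>)) *\<^sub>R (P *v (A *v e))) \<le> (L - \<mu>) / (L + \<mu>) * norm e"
      by (rule norm_linearized_step_le[OF setting eig orthonormal[rule_format] P_def])
    have pre: "norm (P *v w) \<le> \<mu> / \<epsilon> * norm w"
      by (rule norm_preconditioner_le[OF setting eig orthonormal[rule_format] P_def])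
    \<comment> \<open>As \<open>grad E xstar = 0\<close>, the vector \<open>w\<close> is exactly the
      Taylor remainder between \<open>xstar\<close> and \<open>x n\<close>.\<close>
    have "norm w \<le> M / 2 * (norm e)\<^sup>2"
      using grad_taylor_remainder[OF C2 _ xn, of M] lipschitz M_pos saddle
      by (simp add: w_def A_def e_def index_saddle_def)
    then have "\<mu> / \<epsilon> * norm w \<le> \<mu> / \<epsilon> * (M / 2 * (norm e)\<^sup>2)"
      using pos by (intro mult_left_mono) auto
    then have Pw: "norm (P *v w) \<le> \<mu> / \<epsilon> * (M / 2 * (norm e)\<^sup>2)" using pre by simp
    have sum_P: "(\<Sum>i=1..k. (1 + \<eta> n / \<bar>lam n i\<bar>) *\<^sub>R outer (u n i) (u n i))
        = (\<Sum>i=1..k. (1 + \<mu> / \<bar>eigval A i\<bar>) *\<^sub>R outer (u n i) (u n i))"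
      using eta lam by (intro sum.cong) (auto simp: A_def)
    have "x (Suc n) - xstar = e - (2 / (L + \<mu>)) *\<^sub>R (P *v grad E (x n))"
      unfolding step[rule_format] sum_P P_def[symmetric] by (simp add: e_def beta)
    also have "grad E (x n) = A *v e - w" by (simp add: w_def)
    \<comment> \<open>Separates the contracting linearized step from the preconditioned remainder,
      which is quadratic in \<open>e\<close>.\<close>
    also have "e - (2 / (L + \<mu>)) *\<^sub>R (P *v (A *v e - w))
        = (e - (2 / (L + \<mu>)) *\<^sub>R (P *v (A *v e))) + (2 / (L + \<mu>)) *\<^sub>R (P *v w)"
      by (simp add: matrix_vector_mult_diff_distrib algebra_simps)
    finally have "r (Suc n) \<le> norm (e - (2 / (L + \<mu>)) *\<^sub>R (P *v (A *v e)))
        + norm ((2 / (L + \<mu>)) *\<^sub>R (P *v w))"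
      unfolding r_def by (simp only: norm_triangle_ineq)
    also have "norm ((2 / (L + \<mu>)) *\<^sub>R (P *v w)) = 2 / (L + \<mu>) * norm (P *v w)"
      using pos by simp
    also have "norm (e - (2 / (L + \<mu>)) *\<^sub>R (P *v (A *v e))) + 2 / (L + \<mu>) * norm (P *v w)
        \<le> (L - \<mu>) / (L + \<mu>) * norm e + 2 / (L + \<mu>) * (\<mu> / \<epsilon> * (M / 2 * (norm e)\<^sup>2))"
      using lin Pw pos by (intro add_mono mult_left_mono) auto
    also have "(L - \<mu>) / (L + \<mu>) = 1 - q" using pos by (simp add: q_def field_simps)
    \<comment> \<open>The constants combine to \<open>q * M / (2 * \<epsilon>)\<close>, and
      \<open>M / (2 * \<epsilon>)\<close> is the reciprocal of \<open>rhat\<close>.\<close>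
    also have "2 / (L + \<mu>) * (\<mu> / \<epsilon> * (M / 2 * (norm e)\<^sup>2)) = q * (norm e)\<^sup>2 / rhat"
      using pos M_pos by (simp add: q_def rhat)
    finally show ?thesis by (simp add: r_def e_def)
  qed
  have rate_eq: "1 / (1 + q) = 1 - 2 / (\<kappa> + 3)"
  proof -
    have D: "L + 3 * \<mu> > 0" using pos by simp
    have "1 + q = (L + 3 * \<mu>) / (L + \<mu>)" using pos by (simp add: q_def field_simps)
    then have "1 / (1 + q) = (L + \<mu>) / (L + 3 * \<mu>)" by simp
    moreover have "\<kappa> + 3 = (L + 3 * \<mu>) / \<mu>" using pos by (simp add: kappa field_simps)
    then have "2 / (\<kappa> + 3) = 2 * \<mu> / (L + 3 * \<mu>)" by simp
    moreover have "(L + \<mu>) / (L + 3 * \<mu>) = 1 - 2 * \<mu> / (L + 3 * \<mu>)"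
      using D by (simp add: field_simps)
    ultimately show ?thesis by simp
  qed
  have q_pos: "q > 0" using pos by (simp add: q_def)
  have rate: "norm (x n - xstar) \<le> (1 - 2 / (\<kappa> + 3)) ^ n * (rhat * r0 / (rhat - r0))" for n
    using quadratic_recursion_rate[of r rhat q n] rec q_pos init r00 rate_eq
    by (simp add: r_def)
  \<comment> \<open>Positivity of \<open>q\<close> makes the ratio strictly less than 1, so the
    geometric bound tends to 0 and squeezes the error.\<close>
  have "0 < 1 + q" using q_pos by linarith
  then have "norm (1 / (1 + q)) < 1" using q_pos by (simp add: norm_divide divide_less_eq)
  then have lim: "(\<lambda>n. (1 - 2 / (\<kappa> + 3)) ^ n * (rhat * r0 / (rhat - r0))) \<longlonglongrightarrow> 0"
    unfolding rate_eq by (rule tendsto_mult_left_zero[OF LIMSEQ_power_zero])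
  have "(\<lambda>n. x n - xstar) \<longlonglongrightarrow> 0"
    using rate by (auto intro: Lim_null_comparison[OF _ lim])
  then show ?thesis using rate by (auto dest: LIM_zero_cancel)
qed

end
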